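(* Let $n\ge1$ be an integer and $k\in\mathbf{N}_0$. Let $u_0,u_1\in L^2(\mathbf{R}^n)\cap L^{1,k}(\mathbf{R}^n)$, put $v:=u_0+u_1$, and let $\hat u$ be the Fourier-side solution associated with $(u_0,u_1)$ (see context). Then there exists a constant $\delta\ge1$, depending on $u_0$ and $u_1$, such that $$\left\|\hat u(t)-A^v_{k-1}\,e^{-t|\xi|^2}\right\|_2\ge\frac12\left\|B_k^v\,e^{-|\xi|^2}\right\|_{L^2(|\xi|\le1/2)}\,t^{-\frac n4-\frac k2}\qquad\text{for all } t\ge\delta .$$
   Context: Notation. $\mathbf{N}_0=\{0,1,2,\dots\}$; $\|\cdot\|_2$ is the $L^2(\mathbf{R}^n)$ norm in the variable $\xi$, and $\|\cdot\|_{L^2(|\xi|\le1/2)}$ the $L^2$ norm over $\{\xi\in\mathbf{R}^n:|\xi|\le1/2\}$. The Fourier transform is $\hat f(\xi)=\int_{\mathbf{R}^n}e^{-ix\cdot\xi}f(x)\,dx$ (extended to $L^2$ as usual). Weighted space: for $\gamma\ge0$, $L^{1,\gamma}(\mathbf{R}^n)=\{f\in L^1(\mathbf{R}^n): \|f\|_{1,\gamma}:=\int_{\mathbf{R}^n}(1+|x|)^\gamma|f(x)|\,dx<\infty\}$. Fourier-side solution: for $u_0,u_1\in L^2(\mathbf{R}^n)$, the solution of the Cauchy problem $u_{tt}-\Delta u+u_t-\Delta u_t=0$, $u(0,x)=u_0(x)$, $u_t(0,x)=u_1(x)$, is regarded as the function whose Fourier transform in $x$ is, for $t\ge0$ and (almost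 every) $\xi$ with $|\xi|\ne1$, $$\hat u(t,\xi)=\frac{e^{-t|\xi|^2}-|\xi|^2e^{-t}}{1-|\xi|^2}\,\widehat{u_0}(\xi)+\frac{e^{-t|\xi|^2}-e^{-t}}{1-|\xi|^2}\,\widehat{u_1}(\xi).$$ Moments: for $v\in L^{1,k}(\mathbf{R}^n)$ and a multi-index $\alpha\in\mathbf{N}_0^n$ with $|\alpha|\le k$, $M_\alpha(v)=\frac{(-1)^{|\alpha|}}{\alpha!}\int_{\mathbf{R}^n}x^\alpha v(x)\,dx$. Profile functions: for $k\in\mathbf{N}_0$ and $v\in L^{1,k}(\mathbf{R}^n)$, $$A_k^v(\xi)=\sum_{j=0}^{k/2}|\xi|^{k-2j}\sum_{|\alpha|\le 2j}M_\alpha(v)(i\xi)^\alpha\quad(k\text{ even}),\qquad A_k^v(\xi)=\sum_{j=0}^{(k-1)/2}|\xi|^{k-1-2j}\sum_{|\alpha|\le 2j+1}M_\alpha(v)(i\xi)^\alpha\quad(k\text{ odd}),$$ with $A_{-1}^v\equiv0$, and $$B_k^v(\xi)=\sum_{j=0}^{k/2}|\xi|^{k-2j}\sum_{|\alpha|=2j}M_\alpha(v)(i\xi)^\alpha\quad(k\text{ even}),\qquad B_k^v(\xi)=\sum_{j=0}^{(k-1)/2}|\xi|^{k-1-2j}\sum_{|\alpha|=2j+1}M_\alpha(v)(i\xi)^\alpha\quad(k\text{ odd}).$$ *)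

theory Defs
  imports "HOL-Analysis.Analysis"
begin

text \<open>Functions on R^n are complex-valued functions on \<open>real ^ 'n\<close> with \<open>n = CARD('n)\<close>,
  and integrals are Lebesgue integrals. Multi-indices are elements of \<open>nat ^ 'n\<close>.\<close>

text \<open>The L^2 norm over \<open>S\<close> as an element of \<open>[0,\<infinity>]\<close>. The case distinction is the
  extension of the square root to \<open>\<infinity>\<close>.\<close>

definition L2_norm_on :: "'a::euclidean_space set \<Rightarrow> ('a \<Rightarrow> complex) \<Rightarrow> ennreal" where
  "L2_norm_on S f =
     (let I = (\<integral>\<^sup>+\<xi>\<in>S. ennreal ((cmod (f \<xi>))\<^sup>2) \<partial>lebesgue)
      in if I = \<infinity> then \<infinity> else ennreal (sqrt (enn2real I)))"

abbreviation L2_norm :: "('a::euclidean_space \<Rightarrow> complex) \<Rightarrow> ennreal" where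
  "L2_norm \<equiv> L2_norm_on UNIV"

definition L2_space :: "('a::euclidean_space \<Rightarrow> complex) set" where
  "L2_space = {f \<in> borel_measurable lebesgue. L2_norm f < \<infinity>}"

definition weighted_L1 :: "real \<Rightarrow> ('a::euclidean_space \<Rightarrow> complex) set" where
  "weighted_L1 \<gamma> = {f. integrable lebesgue f \<and>
                      integrable lebesgue (\<lambda>x. (1 + norm x) powr \<gamma> * cmod (f x))}"

text \<open>For f in L^1. On the intersection of L^1 and L^2 it agrees almost everywhere with the
  extension to L^2, so the extension is not needed here.\<close>

definition fourier :: "('a::euclidean_space \<Rightarrow> complex) \<Rightarrow> 'a \<Rightarrow> complex" where
  "fourier f \<xi> = (\<integral>x. exp (- \<i> * complex_of_real (x \<bullet> \<xi>)) * f x \<partial>lebesgue)"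

text \<open>On the null set \<open>norm \<xi> = 1\<close> both quotients take the value 0.\<close>

definition u_hat ::
  "('a::euclidean_space \<Rightarrow> complex) \<Rightarrow> ('a \<Rightarrow> complex) \<Rightarrow> real \<Rightarrow> 'a \<Rightarrow> complex" where
  "u_hat u0 u1 t \<xi> =
     complex_of_real ((exp (- t * (norm \<xi>)\<^sup>2) - (norm \<xi>)\<^sup>2 * exp (- t)) / (1 - (norm \<xi>)\<^sup>2))
       * fourier u0 \<xi>
   + complex_of_real ((exp (- t * (norm \<xi>)\<^sup>2) - exp (- t)) / (1 - (norm \<xi>)\<^sup>2))
       * fourier u1 \<xi>"

definition mi_abs :: "nat ^ 'n::finite \<Rightarrow> nat" where
  "mi_abs \<alpha> = (\<Sum>i\<in>UNIV. \<alpha> $ i)"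

definition mi_fact :: "nat ^ 'n::finite \<Rightarrow> nat" where
  "mi_fact \<alpha> = (\<Prod>i\<in>UNIV. fact (\<alpha> $ i))"

definition mi_power :: "'a::comm_semiring_1 ^ 'n::finite \<Rightarrow> nat ^ 'n \<Rightarrow> 'a" where
  "mi_power x \<alpha> = (\<Prod>i\<in>UNIV. (x $ i) ^ (\<alpha> $ i))"

text \<open>The sums over multi-indices below are therefore genuine finite sums.\<close>

lemma finite_mi_abs_le: "finite {\<alpha> :: nat ^ 'n::finite. mi_abs \<alpha> \<le> m}"
proof (rule finite_subset)
  show "{\<alpha> :: nat ^ 'n. mi_abs \<alpha> \<le> m} \<subseteq> vec_lambda ` (UNIV \<rightarrow>\<^sub>E {..m})"
  proof
    fix \<alpha> :: "nat ^ 'n" assume "\<alpha> \<in> {\<alpha>. mi_abs \<alpha> \<le> m}"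
    then have "(\<Sum>i\<in>UNIV. \<alpha> $ i) \<le> m"
      by (simp add: mi_abs_def)
    moreover have "\<alpha> $ i \<le> (\<Sum>i\<in>UNIV. \<alpha> $ i)" for i
      by (rule member_le_sum) simp_all
    ultimately have "vec_nth \<alpha> \<in> UNIV \<rightarrow>\<^sub>E {..m}"
      by (auto simp: PiE_UNIV_domain Pi_iff intro: order_trans)
    then show "\<alpha> \<in> vec_lambda ` (UNIV \<rightarrow>\<^sub>E {..m})"
      by (rule rev_image_eqI) simp
  qed
  show "finite (vec_lambda ` ((UNIV :: 'n set) \<rightarrow>\<^sub>E {..m}))"
    by (intro finite_imageI finite_PiE) simp_all
qed

definition moment :: "nat ^ 'n::finite \<Rightarrow> (real ^ 'n \<Rightarrow> complex) \<Rightarrow> complex" where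
  "moment \<alpha> v = (-1) ^ mi_abs \<alpha> / of_nat (mi_fact \<alpha>)
     * (\<integral>x. complex_of_real (mi_power x \<alpha>) * v x \<partial>lebesgue)"

text \<open>\<open>M_\<alpha>(v) (i\<xi>)^\<alpha>\<close>\<close>

definition moment_term ::
  "(real ^ 'n::finite \<Rightarrow> complex) \<Rightarrow> real ^ 'n \<Rightarrow> nat ^ 'n \<Rightarrow> complex" where
  "moment_term v \<xi> \<alpha> = moment \<alpha> v * mi_power (\<chi> l. \<i> * complex_of_real (\<xi> $ l)) \<alpha>"

text \<open>The index is an integer so that the convention for index -1 can be stated. In the sums,
  \<open>2 * j\<close> never exceeds the number it is subtracted from.\<close>

definition profile_A ::
  "int \<Rightarrow> (real ^ 'n::finite \<Rightarrow> complex) \<Rightarrow> real ^ 'n \<Rightarrow> complex" where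
  "profile_A m v \<xi> =
     (if m < 0 then 0
      else let k = nat m in
        if even k then
          (\<Sum>j = 0..k div 2. complex_of_real (norm \<xi>) ^ (k - 2 * j) *
             (\<Sum>\<alpha> | mi_abs \<alpha> \<le> 2 * j. moment_term v \<xi> \<alpha>))
        else
          (\<Sum>j = 0..(k - 1) div 2. complex_of_real (norm \<xi>) ^ (k - 1 - 2 * j) *
             (\<Sum>\<alpha> | mi_abs \<alpha> \<le> 2 * j + 1. moment_term v \<xi> \<alpha>)))"

definition profile_B ::
  "nat \<Rightarrow> (real ^ 'n::finite \<Rightarrow> complex) \<Rightarrow> real ^ 'n \<Rightarrow> complex" where
  "profile_B k v \<xi> =
     (if even k then
        (\<Sum>j = 0..k div 2. complex_of_real (norm \<xi>) ^ (k - 2 * j) *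
           (\<Sum>\<alpha> | mi_abs \<alpha> = 2 * j. moment_term v \<xi> \<alpha>))
      else
        (\<Sum>j = 0..(k - 1) div 2. complex_of_real (norm \<xi>) ^ (k - 1 - 2 * j) *
           (\<Sum>\<alpha> | mi_abs \<alpha> = 2 * j + 1. moment_term v \<xi> \<alpha>)))"

end

theory Submission
  imports Defs "HOL-Probability.Characteristic_Functions" "HOL-Real_Asymp.Real_Asymp"
begin

text \<open>Let \<open>H\<^sub>m\<close> be the homogeneous part of degree \<open>m\<close> of the moment expansion of the Fourier transform
  of \<open>v\<close>, and \<open>r = |\<xi>|\<close>. Then \<open>B\<^sub>k\<close> is the degree-\<open>k\<close> part of \<open>(1 + r^2 + r^4 + \<dots>) (H\<^sub>0 + H\<^sub>1 + \<dots>)\<close> and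
  \<open>A\<^sub>k = B\<^sub>0 + \<dots> + B\<^sub>k\<close>, so near the origin the solution minus its profile is
  \<open>exp (- t r^2) (B\<^sub>k + o(r^k)) + O(exp (- t))\<close>. On the ball \<open>r \<le> t^(-1/2) / 2\<close>, the substitution
  \<open>\<xi> = t^(-1/2) \<eta>\<close> and the homogeneity of \<open>B\<^sub>k\<close> turn the leading term into the right-hand side, with the
  factor 1/2 absorbing the error for large \<open>t\<close>.\<close>

section \<open>Multinomial expansion and homogeneous parts\<close>

text \<open>Dividing by \<open>fact m\<close> makes the insertion of one index a Cauchy product, as
  for the series of exp (a + b): the exponent at the new index is convolved with those on the rest.
  Exponents forced to be 0 off \<open>S\<close> keep the index set finite and turn the update at the
  new index into a bijection.\<close>

lemma multinomial_fact:
  fixes y :: "'i \<Rightarrow> 'a::{real_normed_field,banach}"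
  assumes "finite S"
  shows "(\<Sum>i\<in>S. y i) ^ m / fact m =
    (\<Sum>\<alpha> | (\<forall>i. i \<notin> S \<longrightarrow> \<alpha> i = 0) \<and> (\<Sum>i\<in>S. \<alpha> i) = m. \<Prod>i\<in>S. y i ^ \<alpha> i / fact (\<alpha> i))"
  using assms
proof (induction S arbitrary: m rule: finite_induct)
  case empty
  have "{\<alpha> :: 'i \<Rightarrow> nat. \<forall>i. \<alpha> i = 0} = {\<lambda>_. 0}"
    by auto
  then show ?case
    by (cases "m = 0") simp_all
next
  case (insert a S)
  let ?E = "\<lambda>S m. {\<alpha> :: 'i \<Rightarrow> nat. (\<forall>i. i \<notin> S \<longrightarrow> \<alpha> i = 0) \<and> (\<Sum>i\<in>S. \<alpha> i) = m}"
  have fin: "finite (?E S m)" for m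
  proof (rule finite_subset)
    show "?E S m \<subseteq> {f. \<forall>i. (i \<in> S \<longrightarrow> f i \<in> {..m}) \<and> (i \<notin> S \<longrightarrow> f i = 0)}"
      using insert.hyps(1) by (auto intro: member_le_sum)
    show "finite {f :: 'i \<Rightarrow> nat. \<forall>i. (i \<in> S \<longrightarrow> f i \<in> {..m}) \<and> (i \<notin> S \<longrightarrow> f i = 0)}"
      by (rule finite_set_of_finite_funs) (use insert.hyps(1) in simp_all)
  qed
  have "(\<Sum>i\<in>insert a S. y i) ^ m / fact m = (y a + (\<Sum>i\<in>S. y i)) ^ m / fact m"
    using insert.hyps by simp
  also have "\<dots> = (\<Sum>j\<le>m. (y a ^ j / fact j) * ((\<Sum>i\<in>S. y i) ^ (m - j) / fact (m - j)))"
    using exp_series_add_commuting[of "y a" "\<Sum>i\<in>S. y i" m]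
    by (simp add: scaleR_conv_of_real mult.commute divide_inverse)
  also have "\<dots> = (\<Sum>j\<le>m. \<Sum>\<alpha>\<in>?E S (m - j). (y a ^ j / fact j) * (\<Prod>i\<in>S. y i ^ \<alpha> i / fact (\<alpha> i)))"
    by (simp add: insert.IH sum_distrib_left)
  also have "\<dots> = (\<Sum>(j, \<alpha>)\<in>(SIGMA j:{..m}. ?E S (m - j)).
      (y a ^ j / fact j) * (\<Prod>i\<in>S. y i ^ \<alpha> i / fact (\<alpha> i)))"
    using fin by (subst sum.Sigma) auto
  also have "\<dots> = (\<Sum>\<alpha>\<in>?E (insert a S) m. \<Prod>i\<in>insert a S. y i ^ \<alpha> i / fact (\<alpha> i))"
  proof (rule sum.reindex_bij_witness[where i = "\<lambda>\<alpha>. (\<alpha> a, \<alpha>(a := 0))" and j = "\<lambda>(j, \<alpha>). \<alpha>(a := j)"])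
    fix p assume p: "p \<in> (SIGMA j:{..m}. ?E S (m - j))"
    obtain j \<alpha> where [simp]: "p = (j, \<alpha>)" by (cases p)
    have s: "(\<Sum>i\<in>S. (\<alpha>(a := j)) i) = (\<Sum>i\<in>S. \<alpha> i)"
      using insert.hyps by (intro sum.cong) auto
    have pr: "(\<Prod>i\<in>S. y i ^ (\<alpha>(a := j)) i / fact ((\<alpha>(a := j)) i)) = (\<Prod>i\<in>S. y i ^ \<alpha> i / fact (\<alpha> i))"
      using insert.hyps by (intro prod.cong) auto
    show "(\<lambda>\<alpha>. (\<alpha> a, \<alpha>(a := 0))) ((\<lambda>(j, \<alpha>). \<alpha>(a := j)) p) = p"
      using p insert.hyps by auto
    show "(\<lambda>(j, \<alpha>). \<alpha>(a := j)) p \<in> ?E (insert a S) m"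
      using p insert.hyps s by auto
    show "(\<Prod>i\<in>insert a S. y i ^ ((\<lambda>(j, \<alpha>). \<alpha>(a := j)) p) i / fact (((\<lambda>(j, \<alpha>). \<alpha>(a := j)) p) i)) =
      (case p of (j, \<alpha>) \<Rightarrow> (y a ^ j / fact j) * (\<Prod>i\<in>S. y i ^ \<alpha> i / fact (\<alpha> i)))"
      using insert.hyps pr by simp
  next
    fix \<alpha> assume \<alpha>: "\<alpha> \<in> ?E (insert a S) m"
    have "(\<Sum>i\<in>S. (\<alpha>(a := 0)) i) = (\<Sum>i\<in>S. \<alpha> i)"
      using insert.hyps by (intro sum.cong) auto
    then show "(\<alpha> a, \<alpha>(a := 0)) \<in> (SIGMA j:{..m}. ?E S (m - j))"
      using \<alpha> insert.hyps by auto
    show "(\<lambda>(j, \<alpha>). \<alpha>(a := j)) (\<alpha> a, \<alpha>(a := 0)) = \<alpha>"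
      by simp
  qed
  finally show ?case .
qed

lemma sum_mi_power_div_fact:
  fixes y :: "'a::{real_normed_field,banach} ^ 'n::finite"
  shows "(\<Sum>\<alpha> | mi_abs \<alpha> = m. mi_power y \<alpha> / of_nat (mi_fact \<alpha>)) = (\<Sum>i\<in>UNIV. y $ i) ^ m / fact m"
proof -
  have "(\<Sum>\<alpha> | mi_abs \<alpha> = m. mi_power y \<alpha> / of_nat (mi_fact \<alpha>)) =
    (\<Sum>\<alpha> | (\<forall>i. i \<notin> (UNIV :: 'n set) \<longrightarrow> \<alpha> i = 0) \<and> (\<Sum>i\<in>UNIV. \<alpha> i) = m.
      \<Prod>i\<in>UNIV. (y $ i) ^ \<alpha> i / fact (\<alpha> i))"
    by (rule sum.reindex_bij_witness[where i = vec_lambda and j = vec_nth])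
      (auto simp: mi_abs_def mi_power_def mi_fact_def prod_dividef vec_lambda_inverse)
  then show ?thesis
    by (simp only: multinomial_fact[OF finite_class.finite_UNIV])
qed

lemma finite_mi_abs_eq [simp]: "finite {\<alpha> :: nat ^ 'n::finite. mi_abs \<alpha> = m}"
  by (rule finite_subset[OF _ finite_mi_abs_le[of m]]) auto

definition hom_part :: "nat \<Rightarrow> (real ^ 'n::finite \<Rightarrow> complex) \<Rightarrow> real ^ 'n \<Rightarrow> complex" where
  "hom_part m v \<xi> = (\<Sum>\<alpha> | mi_abs \<alpha> = m. moment_term v \<xi> \<alpha>)"

lemma sum_moment_term_Suc:
  "(\<Sum>\<alpha> | mi_abs \<alpha> \<le> Suc m. moment_term v \<xi> \<alpha>) =
   (\<Sum>\<alpha> | mi_abs \<alpha> \<le> m. moment_term v \<xi> \<alpha>) + hom_part (Suc m) v \<xi>"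
proof -
  have *: "{\<alpha> :: nat ^ 'n. mi_abs \<alpha> \<le> Suc m} = {\<alpha>. mi_abs \<alpha> \<le> m} \<union> {\<alpha>. mi_abs \<alpha> = Suc m}"
    by auto
  show ?thesis
    unfolding hom_part_def *
    by (rule sum.union_disjoint) (auto simp: finite_mi_abs_le)
qed

lemma mi_power_scaleR:
  "mi_power (\<chi> l. \<i> * complex_of_real ((c *\<^sub>R \<xi>) $ l)) \<alpha> =
   complex_of_real c ^ mi_abs \<alpha> * mi_power (\<chi> l. \<i> * complex_of_real (\<xi> $ l)) \<alpha>"
  by (simp add: mi_power_def mi_abs_def power_sum power_mult_distrib prod.distrib algebra_simps)

lemma hom_part_scaleR: "hom_part m v (c *\<^sub>R \<xi>) = complex_of_real c ^ m * hom_part m v \<xi>"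
  unfolding hom_part_def moment_term_def mi_power_scaleR sum_distrib_left
  by (rule sum.cong) auto

lemma continuous_on_hom_part: "continuous_on S (hom_part m v)"
  unfolding hom_part_def moment_term_def mi_power_def by (intro continuous_intros)

section \<open>Recursions, homogeneity and bounds for the profiles\<close>

lemma profile_B_even:
  "profile_B (2 * m) v \<xi> =
   (\<Sum>j = 0..m. complex_of_real (norm \<xi>) ^ (2 * m - 2 * j) * hom_part (2 * j) v \<xi>)"
  by (simp add: profile_B_def hom_part_def)

lemma profile_B_odd:
  "profile_B (Suc (2 * m)) v \<xi> =
   (\<Sum>j = 0..m. complex_of_real (norm \<xi>) ^ (2 * m - 2 * j) * hom_part (Suc (2 * j)) v \<xi>)"
  by (simp add: profile_B_def hom_part_def)

lemma profile_A_even: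
  "profile_A (int (2 * m)) v \<xi> =
   (\<Sum>j = 0..m. complex_of_real (norm \<xi>) ^ (2 * m - 2 * j) *
      (\<Sum>\<alpha> | mi_abs \<alpha> \<le> 2 * j. moment_term v \<xi> \<alpha>))"
  unfolding profile_A_def Let_def nat_int by simp

lemma profile_A_odd:
  "profile_A (int (Suc (2 * m))) v \<xi> =
   (\<Sum>j = 0..m. complex_of_real (norm \<xi>) ^ (2 * m - 2 * j) *
      (\<Sum>\<alpha> | mi_abs \<alpha> \<le> Suc (2 * j). moment_term v \<xi> \<alpha>))"
  unfolding profile_A_def Let_def nat_int by simp

lemma profile_B_0: "profile_B 0 v \<xi> = hom_part 0 v \<xi>"
  using profile_B_even[of 0 v \<xi>] by simp

lemma profile_B_1: "profile_B (Suc 0) v \<xi> = hom_part (Suc 0) v \<xi>"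
  using profile_B_odd[of 0 v \<xi>] by simp

text \<open>Multiplication by r^2 raises the power of r in every summand by two, and the only new
  summand is the top one, with r^0. This permits two-step inductions that treat even and odd degrees
  alike.\<close>

lemma profile_B_Suc_Suc:
  "profile_B (Suc (Suc k)) v \<xi> =
   hom_part (Suc (Suc k)) v \<xi> + complex_of_real ((norm \<xi>)\<^sup>2) * profile_B k v \<xi>"
proof (cases "even k")
  case True
  then obtain m where k: "k = 2 * m" by blast
  have "(\<Sum>j = 0..m. complex_of_real (norm \<xi>) ^ (2 * Suc m - 2 * j) * hom_part (2 * j) v \<xi>) =
    complex_of_real ((norm \<xi>)\<^sup>2) * profile_B k v \<xi>"
    unfolding k profile_B_even sum_distrib_left
    by (intro sum.cong) (auto simp: Suc_diff_le power2_eq_square)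
  then show ?thesis
    using profile_B_even[of "Suc m" v \<xi>] by (simp add: k)
next
  case False
  then obtain m where k: "k = Suc (2 * m)" by (auto elim: oddE)
  have "(\<Sum>j = 0..m. complex_of_real (norm \<xi>) ^ (2 * Suc m - 2 * j) * hom_part (Suc (2 * j)) v \<xi>) =
    complex_of_real ((norm \<xi>)\<^sup>2) * profile_B k v \<xi>"
    unfolding k profile_B_odd sum_distrib_left
    by (intro sum.cong) (auto simp: Suc_diff_le power2_eq_square)
  then show ?thesis
    using profile_B_odd[of "Suc m" v \<xi>] by (simp add: k)
qed

text \<open>Consecutive indices have opposite parity. For odd \<open>k\<close> the sums over
  \<open>j\<close> have the same range and the same powers of r, and each inner sum gains one
  degree. For even \<open>k\<close> the range also gains the term \<open>j = 0\<close>, and the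
  others must be shifted by one to match.\<close>

lemma profile_A_step: "profile_A (int k) v \<xi> = profile_A (int k - 1) v \<xi> + profile_B k v \<xi>"
proof (cases "even k")
  case False
  then obtain m where k: "k = Suc (2 * m)" by (auto elim: oddE)
  have "int k - 1 = int (2 * m)" by (simp add: k)
  then show ?thesis
    by (simp only: k profile_A_odd profile_A_even profile_B_odd sum_moment_term_Suc ring_distribs
        sum.distrib)
next
  case True
  then obtain m where k: "k = 2 * m" by blast
  have 0: "(\<Sum>\<alpha> | mi_abs \<alpha> = 0. moment_term v \<xi> \<alpha>) = hom_part 0 v \<xi>"
    by (simp add: hom_part_def)
  show ?thesis
  proof (cases m)
    case 0
    then show ?thesis
      using profile_A_even[of 0 v \<xi>] by (simp add: k profile_A_def profile_B_def)
  next
    case (Suc m')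
    have "int k - 1 = int (Suc (2 * m'))" by (simp add: k Suc)
    moreover have "profile_A (int (2 * Suc m')) v \<xi> =
        complex_of_real (norm \<xi>) ^ (2 * Suc m') * hom_part 0 v \<xi> +
        (\<Sum>j = 0..m'. complex_of_real (norm \<xi>) ^ (2 * m' - 2 * j) *
           (\<Sum>\<alpha> | mi_abs \<alpha> \<le> Suc (Suc (2 * j)). moment_term v \<xi> \<alpha>))"
      unfolding profile_A_even by (simp add: sum.atLeast0_atMost_Suc_shift 0 del: sum.cl_ivl_Suc)
    moreover have "profile_B (2 * Suc m') v \<xi> =
        complex_of_real (norm \<xi>) ^ (2 * Suc m') * hom_part 0 v \<xi> +
        (\<Sum>j = 0..m'. complex_of_real (norm \<xi>) ^ (2 * m' - 2 * j) * hom_part (Suc (Suc (2 * j))) v \<xi>)"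
      unfolding profile_B_even by (simp add: sum.atLeast0_atMost_Suc_shift del: sum.cl_ivl_Suc)
    ultimately show ?thesis
      by (simp only: k Suc profile_A_odd sum_moment_term_Suc[where m = "Suc _"] ring_distribs sum.distrib) simp
  qed
qed

text \<open>Multiplying by \<open>1 - r^2\<close> avoids the geometric series; the leftover is \<open>O(r^(k+1))\<close>.\<close>

lemma profile_A_telescope:
  "(1 - complex_of_real ((norm \<xi>)\<^sup>2)) * profile_A (int k) v \<xi> =
   (\<Sum>m\<le>k. hom_part m v \<xi>) - complex_of_real ((norm \<xi>)\<^sup>2) *
     (profile_B k v \<xi> + (if k = 0 then 0 else profile_B (k - 1) v \<xi>))"
proof (induction k)
  case 0
  have "profile_A (-1) v \<xi> = 0" by (simp add: profile_A_def)
  then show ?case using profile_A_step[of 0 v \<xi>] by (simp add: profile_B_0 algebra_simps)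
next
  case (Suc k)
  have "profile_A (int (Suc k)) v \<xi> = profile_A (int k) v \<xi> + profile_B (Suc k) v \<xi>"
    using profile_A_step[of "Suc k" v \<xi>] by simp
  \<comment> \<open>The recursion one degree down. The \<open>if\<close> stands for B with index -1,
    which is 0, where \<open>k - 1\<close> would truncate to 0.\<close>
  moreover have "profile_B (Suc k) v \<xi> = hom_part (Suc k) v \<xi> +
      complex_of_real ((norm \<xi>)\<^sup>2) * (if k = 0 then 0 else profile_B (k - 1) v \<xi>)"
    by (cases k) (simp_all add: profile_B_1 profile_B_Suc_Suc)
  ultimately show ?case using Suc.IH by (simp add: algebra_simps)
qed

lemma profile_B_scaleR:
  assumes "0 \<le> c"
  shows "profile_B k v (c *\<^sub>R \<xi>) = complex_of_real c ^ k * profile_B k v \<xi>"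
proof (induction k rule: induct_nat_012)
  case (ge2 n)
  then show ?case
    using assms
    by (simp add: profile_B_Suc_Suc hom_part_scaleR power_mult_distrib algebra_simps power2_eq_square)
qed (simp_all add: profile_B_0 profile_B_1 hom_part_scaleR)

lemma continuous_on_profile_B: "continuous_on S (profile_B k v)"
proof (induction k rule: induct_nat_012)
  case (ge2 n)
  then show ?case
    unfolding profile_B_Suc_Suc by (intro continuous_intros continuous_on_hom_part)
qed (simp_all add: profile_B_0 profile_B_1 continuous_on_hom_part cong: continuous_on_cong)

text \<open>Homogeneity reduces the bound to the closed unit ball, where continuity and compactness
  give it.\<close>

lemma profile_B_bound: "\<exists>C\<ge>0. \<forall>\<xi>. cmod (profile_B k v \<xi>) \<le> C * norm \<xi> ^ k"
proof -
  have "compact (profile_B k v ` cball 0 1)"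
    by (intro compact_continuous_image continuous_on_profile_B compact_cball)
  then obtain C where C: "\<And>\<xi>. norm \<xi> \<le> 1 \<Longrightarrow> cmod (profile_B k v \<xi>) \<le> C"
    by (force dest!: compact_imp_bounded simp: bounded_iff)
  have "cmod (profile_B k v \<xi>) \<le> C * norm \<xi> ^ k" for \<xi>
  proof -
    \<comment> \<open>Since \<open>sgn 0 = 0\<close>, this polar form covers the origin too; hence
      the bound \<open>C\<close> is taken on the ball and not only on the sphere.\<close>
    have "\<xi> = norm \<xi> *\<^sub>R sgn \<xi>" by (cases "\<xi> = 0") (simp_all add: sgn_div_norm)
    then have "profile_B k v \<xi> = complex_of_real (norm \<xi>) ^ k * profile_B k v (sgn \<xi>)"
      by (metis norm_ge_zero profile_B_scaleR)
    moreover have "cmod (profile_B k v (sgn \<xi>)) \<le> C"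
      by (rule C) (simp add: norm_sgn)
    ultimately show ?thesis
      by (simp add: norm_mult norm_power mult.commute[of C] mult_left_mono)
  qed
  moreover have "0 \<le> C" using C[of 0] norm_ge_zero order_trans by (metis norm_zero zero_le_one)
  ultimately show ?thesis by blast
qed

section \<open>Weighted integrability and basic facts on the Fourier transform\<close>

lemma continuous_imp_borel_measurable_lebesgue:
  fixes f :: "'a::euclidean_space \<Rightarrow> 'b::topological_space"
  assumes "continuous_on UNIV f"
  shows "f \<in> borel_measurable lebesgue"
  using borel_measurable_continuous_onI[OF assms] by (intro measurable_completion) simp

lemma weighted_L1_add:
  assumes "f \<in> weighted_L1 \<gamma>" "g \<in> weighted_L1 \<gamma>"
  shows "(\<lambda>x. f x + g x) \<in> weighted_L1 \<gamma>"
proof -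
  have f: "integrable lebesgue f" "integrable lebesgue (\<lambda>x. (1 + norm x) powr \<gamma> * cmod (f x))"
    and g: "integrable lebesgue g" "integrable lebesgue (\<lambda>x. (1 + norm x) powr \<gamma> * cmod (g x))"
    using assms by (auto simp: weighted_L1_def)
  have "integrable lebesgue (\<lambda>x. (1 + norm x) powr \<gamma> * cmod (f x + g x))"
  proof (rule Bochner_Integration.integrable_bound[OF Bochner_Integration.integrable_add[OF f(2) g(2)]])
    show "(\<lambda>x. (1 + norm x) powr \<gamma> * cmod (f x + g x)) \<in> borel_measurable lebesgue"
      using f g
      by (intro borel_measurable_times borel_measurable_norm borel_measurable_add
          borel_measurable_integrable continuous_imp_borel_measurable_lebesgue continuous_intros)
        (auto simp: add_nonneg_eq_0_iff)
    show "AE x in lebesgue. norm ((1 + norm x) powr \<gamma> * cmod (f x + g x))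
        \<le> norm ((1 + norm x) powr \<gamma> * cmod (f x) + (1 + norm x) powr \<gamma> * cmod (g x))"
      by (intro AE_I2) (simp add: abs_mult norm_triangle_ineq mult_left_mono flip: distrib_left)
  qed
  then show ?thesis
    using f g by (auto simp: weighted_L1_def)
qed

lemma integrable_norm_power_weighted_L1:
  assumes "v \<in> weighted_L1 (real k)" "m \<le> k"
  shows "integrable lebesgue (\<lambda>x. norm x ^ m * cmod (v x))"
proof (rule Bochner_Integration.integrable_bound)
  show "integrable lebesgue (\<lambda>x. (1 + norm x) powr real k * cmod (v x))"
    using assms by (simp add: weighted_L1_def)
  have "v \<in> borel_measurable lebesgue"
    using assms by (auto simp: weighted_L1_def)
  from measurable_compose[OF this borel_measurable_norm]
  show "(\<lambda>x. norm x ^ m * cmod (v x)) \<in> borel_measurable lebesgue"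
    by (rule borel_measurable_times[rotated])
      (intro continuous_imp_borel_measurable_lebesgue continuous_intros)
  have "norm x ^ m \<le> (1 + norm x) powr real k" for x :: 'a
  proof -
    have "norm x ^ m \<le> (1 + norm x) ^ m" by (intro power_mono) auto
    also have "\<dots> \<le> (1 + norm x) ^ k" using assms(2) by (intro power_increasing) auto
    also have "\<dots> = (1 + norm x) powr real k"
      by (rule powr_realpow[symmetric]) (simp add: add_pos_nonneg)
    finally show ?thesis .
  qed
  then show "AE x in lebesgue. norm (norm x ^ m * cmod (v x)) \<le> norm ((1 + norm x) powr real k * cmod (v x))"
    by (intro AE_I2) (simp add: abs_mult mult_right_mono)
qed

lemma fourier_integrable:
  assumes "integrable lebesgue f"
  shows "integrable lebesgue (\<lambda>x. exp (- \<i> * complex_of_real (x \<bullet> \<xi>)) * f x)"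
proof (rule Bochner_Integration.integrable_bound[OF assms])
  show "(\<lambda>x. exp (- \<i> * complex_of_real (x \<bullet> \<xi>)) * f x) \<in> borel_measurable lebesgue"
    using assms
    by (intro borel_measurable_times continuous_imp_borel_measurable_lebesgue continuous_intros
        borel_measurable_integrable)
qed (simp add: norm_mult)

lemma fourier_add:
  assumes "integrable lebesgue f" "integrable lebesgue g"
  shows "fourier (\<lambda>x. f x + g x) \<xi> = fourier f \<xi> + fourier g \<xi>"
  unfolding fourier_def
  by (simp add: distrib_left Bochner_Integration.integral_add fourier_integrable[simplified] assms)

lemma fourier_bound: "cmod (fourier f \<xi>) \<le> (\<integral>x. cmod (f x) \<partial>lebesgue)"
  unfolding fourier_def
  by (rule order_trans[OF integral_norm_bound]) (simp add: norm_mult)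

section \<open>Expansions near the origin\<close>

lemma mi_power_bound: "\<bar>mi_power x \<alpha>\<bar> \<le> norm x ^ mi_abs \<alpha>" for x :: "real ^ 'n::finite"
proof -
  have "\<bar>mi_power x \<alpha>\<bar> = (\<Prod>i\<in>UNIV. \<bar>x $ i\<bar> ^ (\<alpha> $ i))"
    by (simp add: mi_power_def abs_prod power_abs)
  also have "\<dots> \<le> (\<Prod>i\<in>UNIV. norm x ^ (\<alpha> $ i))"
    by (intro prod_mono) (auto intro!: power_mono component_le_norm_cart)
  finally show ?thesis by (simp add: mi_abs_def power_sum)
qed

lemma integrable_mi_power:
  fixes v :: "real ^ 'n::finite \<Rightarrow> complex"
  assumes "v \<in> weighted_L1 (real k)" "mi_abs \<alpha> \<le> k"
  shows "integrable lebesgue (\<lambda>x. complex_of_real (mi_power x \<alpha>) * v x)"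
proof (rule Bochner_Integration.integrable_bound[OF integrable_norm_power_weighted_L1[OF assms]])
  have "v \<in> borel_measurable lebesgue"
    using assms by (auto simp: weighted_L1_def)
  moreover have "(\<lambda>x :: real ^ 'n. complex_of_real (mi_power x \<alpha>)) \<in> borel_measurable lebesgue"
    unfolding mi_power_def by (intro continuous_imp_borel_measurable_lebesgue continuous_intros)
  ultimately show "(\<lambda>x. complex_of_real (mi_power x \<alpha>) * v x) \<in> borel_measurable lebesgue"
    by simp
qed (simp add: norm_mult mi_power_bound mult_right_mono)

text \<open>The multinomial expansion of \<open>(x \<bullet> \<xi>) ^ m\<close> separates x from
  \<xi>: powers of x integrate to moments and powers of \<xi> leave the integral. Thus H_m comes
  from the m-th Taylor term of the Fourier kernel.\<close>

lemma hom_part_eq_integral: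
  fixes v :: "real ^ 'n::finite \<Rightarrow> complex"
  assumes "v \<in> weighted_L1 (real k)" "m \<le> k"
  shows "integrable lebesgue (\<lambda>x. (\<i> * complex_of_real (- (x \<bullet> \<xi>))) ^ m / fact m * v x)" (is ?int)
    and "hom_part m v \<xi> = (\<integral>x. (\<i> * complex_of_real (- (x \<bullet> \<xi>))) ^ m / fact m * v x \<partial>lebesgue)" (is ?eq)
proof -
  have eq: "(\<i> * complex_of_real (- (x \<bullet> \<xi>))) ^ m / fact m * v x =
      (\<Sum>\<alpha> | mi_abs \<alpha> = m. (-1) ^ m / of_nat (mi_fact \<alpha>) *
        mi_power (\<chi> l. \<i> * complex_of_real (\<xi> $ l)) \<alpha> * (complex_of_real (mi_power x \<alpha>) * v x))" for x
  proof -
    \<comment> \<open>The sign of the exponent is put on every coordinate, so that it comes out as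
      \<open>(-1) ^ m\<close>, the sign in \<open>moment\<close>.\<close>
    have "\<i> * complex_of_real (- (x \<bullet> \<xi>)) =
        (\<Sum>i\<in>UNIV. (\<chi> l. - (\<i> * complex_of_real (\<xi> $ l) * complex_of_real (x $ l))) $ i)"
      by (simp add: inner_vec_def sum_distrib_left sum_negf mult_ac)
    then have "(\<i> * complex_of_real (- (x \<bullet> \<xi>))) ^ m / fact m =
        (\<Sum>\<alpha> | mi_abs \<alpha> = m. mi_power (\<chi> l. - (\<i> * complex_of_real (\<xi> $ l) * complex_of_real (x $ l))) \<alpha>
           / of_nat (mi_fact \<alpha>))"
      by (simp only: sum_mi_power_div_fact)
    also have "\<dots> = (\<Sum>\<alpha> | mi_abs \<alpha> = m. (-1) ^ m / of_nat (mi_fact \<alpha>) *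
        mi_power (\<chi> l. \<i> * complex_of_real (\<xi> $ l)) \<alpha> * complex_of_real (mi_power x \<alpha>))"
    proof (rule sum.cong[OF refl])
      fix \<alpha> :: "nat ^ 'n" assume "\<alpha> \<in> {\<alpha>. mi_abs \<alpha> = m}"
      then have "(-1 :: complex) ^ m = (\<Prod>i\<in>UNIV. (-1) ^ (\<alpha> $ i))"
        by (auto simp: mi_abs_def power_sum)
      moreover have "mi_power (\<chi> l. - (\<i> * complex_of_real (\<xi> $ l) * complex_of_real (x $ l))) \<alpha> =
         (\<Prod>i\<in>UNIV. (-1) ^ (\<alpha> $ i)) * mi_power (\<chi> l. \<i> * complex_of_real (\<xi> $ l)) \<alpha>
           * complex_of_real (mi_power x \<alpha>)"
        unfolding mi_power_def of_real_prod prod.distrib[symmetric]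
        by (intro prod.cong) (simp_all add: mult_ac flip: power_mult_distrib)
      ultimately show "mi_power (\<chi> l. - (\<i> * complex_of_real (\<xi> $ l) * complex_of_real (x $ l))) \<alpha>
           / of_nat (mi_fact \<alpha>) = (-1) ^ m / of_nat (mi_fact \<alpha>) *
        mi_power (\<chi> l. \<i> * complex_of_real (\<xi> $ l)) \<alpha> * complex_of_real (mi_power x \<alpha>)"
        by simp
    qed
    finally show ?thesis by (simp only: sum_distrib_right mult.assoc)
  qed
  have int: "integrable lebesgue (\<lambda>x. (-1) ^ m / of_nat (mi_fact \<alpha>) *
        mi_power (\<chi> l. \<i> * complex_of_real (\<xi> $ l)) \<alpha> * (complex_of_real (mi_power x \<alpha>) * v x))"
    if "mi_abs \<alpha> = m" for \<alpha>
    using that assms by (intro integrable_mult_right integrable_mi_power) auto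
  show ?int
    unfolding eq using int by (intro Bochner_Integration.integrable_sum) auto
  have "(\<integral>x. (\<i> * complex_of_real (- (x \<bullet> \<xi>))) ^ m / fact m * v x \<partial>lebesgue) =
    (\<Sum>\<alpha> | mi_abs \<alpha> = m. \<integral>x. (-1) ^ m / of_nat (mi_fact \<alpha>) *
        mi_power (\<chi> l. \<i> * complex_of_real (\<xi> $ l)) \<alpha> * (complex_of_real (mi_power x \<alpha>) * v x) \<partial>lebesgue)"
    unfolding eq using int by (intro Bochner_Integration.integral_sum) auto
  also have "\<dots> = hom_part m v \<xi>"
    unfolding hom_part_def moment_term_def moment_def by (intro sum.cong) auto
  finally show ?eq ..
qed

text \<open>The weight controls moments up to order \<open>k\<close> only, so the remainder is
  o(|\<xi>|^k) without a rate. Two remainder bounds for exp (i y) are combined: the one of order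
  |y|^k is integrable against v, the one of order |y|^(k+1) makes the integrand small
  pointwise.\<close>

lemma fourier_taylor:
  fixes v :: "real ^ 'n::finite \<Rightarrow> complex"
  assumes v: "v \<in> weighted_L1 (real k)" and "0 < e"
  shows "\<exists>\<rho>>0. \<forall>\<xi>. norm \<xi> \<le> \<rho> \<longrightarrow>
    cmod (fourier v \<xi> - (\<Sum>m\<le>k. hom_part m v \<xi>)) \<le> e * norm \<xi> ^ k"
proof -
  \<comment> \<open>For |\<xi>| \<le> \<rho> the remainder at x is at most |\<xi>|^k times
    \<open>?g \<rho> x\<close>, because one factor |\<xi>| of the second bound may be replaced by
    \<rho>.\<close>
  let ?g = "\<lambda>\<rho> x. min (2 * norm x ^ k) (\<rho> * norm x ^ Suc k) * cmod (v x)"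
  have "v \<in> borel_measurable lebesgue" and intv: "integrable lebesgue v"
    using v by (auto simp: weighted_L1_def)
  have gm: "?g \<rho> \<in> borel_measurable lebesgue" for \<rho>
    using measurable_compose[OF \<open>v \<in> borel_measurable lebesgue\<close> borel_measurable_norm]
    by (rule borel_measurable_times[rotated])
      (intro continuous_imp_borel_measurable_lebesgue continuous_intros)
  have int2: "integrable lebesgue (\<lambda>x. 2 * norm x ^ k * cmod (v x))"
    using integrable_norm_power_weighted_L1[OF v order_refl] by (simp add: mult.assoc)
  have gint: "integrable lebesgue (?g \<rho>)" if "0 \<le> \<rho>" for \<rho>
    using that
    by (intro Bochner_Integration.integrable_bound[OF int2 gm] AE_I2) (auto simp: abs_mult intro!: mult_right_mono)
  \<comment> \<open>Dominated convergence along \<rho> = 1/(n+1): the second entry of the minimum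
    tends to 0 pointwise, the first one dominates.\<close>
  have "(\<lambda>n. \<integral>x. ?g (inverse (real (Suc n))) x \<partial>lebesgue) \<longlonglongrightarrow> (\<integral>x. 0 \<partial>(lebesgue :: (real ^ 'n) measure))"
  proof (rule integral_dominated_convergence[OF _ gm int2])
    have "(\<lambda>n. ?g (inverse (real (Suc n))) x) \<longlonglongrightarrow> min (2 * norm x ^ k) (0 * norm x ^ Suc k) * cmod (v x)" for x
      by (intro tendsto_intros LIMSEQ_inverse_real_of_nat)
    then show "AE x in lebesgue. (\<lambda>n. ?g (inverse (real (Suc n))) x) \<longlonglongrightarrow> 0"
      by (intro AE_I2) simp
    show "AE x in lebesgue. norm (?g (inverse (real (Suc n))) x) \<le> 2 * norm x ^ k * cmod (v x)" for n
      by (intro AE_I2) (auto simp: abs_mult intro!: mult_right_mono)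
  qed simp
  then have "\<forall>\<^sub>F n in sequentially. (\<integral>x. ?g (inverse (real (Suc n))) x \<partial>lebesgue) < e"
    using \<open>0 < e\<close> by (intro order_tendstoD) auto
  then obtain n where n: "(\<integral>x. ?g (inverse (real (Suc n))) x \<partial>lebesgue) < e"
    by (auto simp: eventually_sequentially)
  define \<rho> where "\<rho> = inverse (real (Suc n))"
  have \<rho>: "0 < \<rho>" "(\<integral>x. ?g \<rho> x \<partial>lebesgue) < e"
    using n by (simp_all add: \<rho>_def)
  have "cmod (fourier v \<xi> - (\<Sum>m\<le>k. hom_part m v \<xi>)) \<le> e * norm \<xi> ^ k" if \<xi>: "norm \<xi> \<le> \<rho>" for \<xi>
  proof -
    let ?T = "\<lambda>x. \<Sum>m\<le>k. (\<i> * complex_of_real (- (x \<bullet> \<xi>))) ^ m / fact m"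
    have intT: "integrable lebesgue (\<lambda>x. ?T x * v x)"
      unfolding sum_distrib_right
      by (intro Bochner_Integration.integrable_sum hom_part_eq_integral(1)[OF v]) auto
    have "(\<Sum>m\<le>k. hom_part m v \<xi>) =
        (\<Sum>m\<le>k. \<integral>x. (\<i> * complex_of_real (- (x \<bullet> \<xi>))) ^ m / fact m * v x \<partial>lebesgue)"
      by (intro sum.cong refl hom_part_eq_integral(2)[OF v]) auto
    also have "\<dots> = (\<integral>x. ?T x * v x \<partial>lebesgue)"
      unfolding sum_distrib_right
      by (intro Bochner_Integration.integral_sum[symmetric] hom_part_eq_integral(1)[OF v]) auto
    finally have "fourier v \<xi> - (\<Sum>m\<le>k. hom_part m v \<xi>) =
        (\<integral>x. exp (- \<i> * complex_of_real (x \<bullet> \<xi>)) * v x - ?T x * v x \<partial>lebesgue)"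
      unfolding fourier_def
      using Bochner_Integration.integral_diff[OF fourier_integrable[OF intv] intT] by simp
    also have "cmod \<dots> \<le> (\<integral>x. norm \<xi> ^ k * ?g \<rho> x \<partial>lebesgue)"
    proof (rule order_trans[OF integral_norm_bound], rule Bochner_Integration.integral_mono)
      show "integrable lebesgue (\<lambda>x. cmod (exp (- \<i> * complex_of_real (x \<bullet> \<xi>)) * v x - ?T x * v x))"
        by (intro integrable_norm Bochner_Integration.integrable_diff fourier_integrable intv intT)
      show "integrable lebesgue (\<lambda>x. norm \<xi> ^ k * ?g \<rho> x)"
        using gint[of \<rho>] \<rho>(1) by (intro integrable_mult_right) auto
      fix x :: "real ^ 'n"
      let ?y = "- (x \<bullet> \<xi>)"
      have y: "\<bar>?y\<bar> \<le> norm x * norm \<xi>"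
        by (simp add: Cauchy_Schwarz_ineq2)
      have "cmod (iexp ?y - ?T x) \<le> 2 * \<bar>?y\<bar> ^ k / fact k"
        by (rule iexp_approx2)
      also have "\<dots> \<le> 2 * \<bar>?y\<bar> ^ k / 1"
        by (intro divide_left_mono) auto
      also have "\<dots> \<le> 2 * (norm x * norm \<xi>) ^ k"
        using power_mono[OF y, of k] by simp
      finally have 1: "cmod (iexp ?y - ?T x) \<le> norm \<xi> ^ k * (2 * norm x ^ k)"
        by (simp add: power_mult_distrib mult_ac)
      have "cmod (iexp ?y - ?T x) \<le> \<bar>?y\<bar> ^ Suc k / fact (Suc k)"
        by (rule iexp_approx1)
      also have "\<dots> \<le> \<bar>?y\<bar> ^ Suc k / 1"
        by (intro divide_left_mono) (auto simp del: fact_Suc)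
      also have "\<dots> \<le> (norm x * norm \<xi>) ^ Suc k"
        using power_mono[OF y, of "Suc k"] by simp
      also have "\<dots> = norm \<xi> ^ k * (norm \<xi> * norm x ^ Suc k)"
        by (simp add: power_mult_distrib mult_ac)
      also have "\<dots> \<le> norm \<xi> ^ k * (\<rho> * norm x ^ Suc k)"
        using \<xi> by (intro mult_left_mono mult_right_mono) auto
      finally have "cmod (iexp ?y - ?T x) \<le> norm \<xi> ^ k * min (2 * norm x ^ k) (\<rho> * norm x ^ Suc k)"
        using 1 by (auto simp: min_def)
      then have "cmod (iexp ?y - ?T x) * cmod (v x) \<le>
          norm \<xi> ^ k * min (2 * norm x ^ k) (\<rho> * norm x ^ Suc k) * cmod (v x)"
        by (rule mult_right_mono) (rule norm_ge_zero)
      then have "cmod (iexp ?y - ?T x) * cmod (v x) \<le> norm \<xi> ^ k * ?g \<rho> x"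
        by (simp only: mult.assoc)
      moreover have "exp (- \<i> * complex_of_real (x \<bullet> \<xi>)) * v x - ?T x * v x = (iexp ?y - ?T x) * v x"
        by (simp add: left_diff_distrib)
      ultimately show "cmod (exp (- \<i> * complex_of_real (x \<bullet> \<xi>)) * v x - ?T x * v x) \<le> norm \<xi> ^ k * ?g \<rho> x"
        by (simp only: norm_mult)
    qed
    also have "\<dots> = norm \<xi> ^ k * (\<integral>x. ?g \<rho> x \<partial>lebesgue)"
      by (rule integral_mult_right_zero)
    also have "\<dots> \<le> norm \<xi> ^ k * e"
      by (intro mult_left_mono less_imp_le[OF \<rho>(2)] zero_le_power norm_ge_zero)
    also have "\<dots> = e * norm \<xi> ^ k"
      by (rule mult.commute)
    finally show ?thesis .
  qed
  with \<rho>(1) show ?thesis by blast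
qed

text \<open>By \<open>profile_A_telescope\<close> the difference is the Taylor remainder plus r^2
  (B_k + B_(k-1)), divided by 1 - r^2. Each of the two terms is at most (e/4) r^k near 0, and the
  division costs at most a factor 2.\<close>

lemma profile_expansion:
  assumes v: "v \<in> weighted_L1 (real k)" and "0 < e"
  shows "\<exists>\<rho>>0. \<forall>\<xi>. norm \<xi> \<le> \<rho> \<longrightarrow>
    cmod (fourier v \<xi> / complex_of_real (1 - (norm \<xi>)\<^sup>2) - profile_A (int k - 1) v \<xi> - profile_B k v \<xi>)
      \<le> e * norm \<xi> ^ k"
proof -
  obtain C where C: "0 \<le> C" "\<And>\<xi>. cmod (profile_B k v \<xi>) \<le> C * norm \<xi> ^ k"
    using profile_B_bound by metis
  obtain D where D: "0 \<le> D" "\<And>\<xi>. cmod (profile_B (k - 1) v \<xi>) \<le> D * norm \<xi> ^ (k - 1)"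
    using profile_B_bound by metis
  obtain \<rho>0 where \<rho>0: "0 < \<rho>0" "\<And>\<xi>. norm \<xi> \<le> \<rho>0 \<Longrightarrow>
      cmod (fourier v \<xi> - (\<Sum>m\<le>k. hom_part m v \<xi>)) \<le> (e / 4) * norm \<xi> ^ k"
    using fourier_taylor[OF v, of "e / 4"] \<open>0 < e\<close> by auto
  \<comment> \<open>The bound 1/2 keeps 1 - r^2 above 1/2, and the last one makes r (C + D + 1) at
    most e/4; the summand 1 keeps its denominator positive.\<close>
  define \<rho> where "\<rho> = Min {\<rho>0, 1 / 2, e / (4 * (C + D + 1))}"
  have "0 < \<rho>"
    using \<rho>0(1) C(1) D(1) \<open>0 < e\<close> by (simp add: \<rho>_def)
  have "cmod (fourier v \<xi> / complex_of_real (1 - (norm \<xi>)\<^sup>2) - profile_A (int k - 1) v \<xi> - profile_B k v \<xi>)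
      \<le> e * norm \<xi> ^ k" if \<xi>: "norm \<xi> \<le> \<rho>" for \<xi>
  proof -
    define r where "r = norm \<xi>"
    have r: "0 \<le> r" "r \<le> \<rho>0" "r \<le> 1 / 2" "r \<le> e / (4 * (C + D + 1))"
      using \<xi> by (simp_all add: \<rho>_def r_def)
    have "r\<^sup>2 \<le> (1 / 2)\<^sup>2" using r by (intro power_mono)
    then have q: "1 / 2 \<le> 1 - r\<^sup>2" by (simp add: power2_eq_square)
    let ?E = "profile_B k v \<xi> + (if k = 0 then 0 else profile_B (k - 1) v \<xi>)"
    have A: "profile_A (int k) v \<xi> = profile_A (int k - 1) v \<xi> + profile_B k v \<xi>"
      by (rule profile_A_step)
    have "complex_of_real (1 - r\<^sup>2) \<noteq> 0" using q by (simp only: of_real_eq_0_iff)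
    then have "fourier v \<xi> / complex_of_real (1 - r\<^sup>2) - profile_A (int k - 1) v \<xi> - profile_B k v \<xi> =
        (fourier v \<xi> - complex_of_real (1 - r\<^sup>2) * profile_A (int k) v \<xi>) / complex_of_real (1 - r\<^sup>2)"
      unfolding A by (simp only: diff_divide_distrib nonzero_mult_div_cancel_left) simp
    also have "\<dots> = ((fourier v \<xi> - (\<Sum>m\<le>k. hom_part m v \<xi>)) + complex_of_real (r\<^sup>2) * ?E)
        / complex_of_real (1 - r\<^sup>2)"
      using profile_A_telescope[of \<xi> k v] by (simp add: r_def)
    finally have eq: "cmod (fourier v \<xi> / complex_of_real (1 - r\<^sup>2) - profile_A (int k - 1) v \<xi> - profile_B k v \<xi>)
        = cmod ((fourier v \<xi> - (\<Sum>m\<le>k. hom_part m v \<xi>)) + complex_of_real (r\<^sup>2) * ?E) / (1 - r\<^sup>2)"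
      using q by (simp only: norm_divide norm_of_real)
    have "r\<^sup>2 * cmod ?E \<le> r\<^sup>2 * (C * r ^ k + (if k = 0 then 0 else D * r ^ (k - 1)))"
      using C(2)[of \<xi>] D(2)[of \<xi>]
      by (intro mult_left_mono) (auto intro!: norm_triangle_mono simp: r_def)
    \<comment> \<open>The B_(k-1) term is exactly of order r^(k+1) and absent for
      \<open>k = 0\<close>; the B_k term has a power to spare, given up by r \<le> 1.\<close>
    also have "\<dots> \<le> r ^ k * (r * (C + D + 1))"
    proof (cases k)
      case 0
      have "r * (r * C) \<le> 1 * (r * C)" using r C by (intro mult_right_mono) auto
      moreover have "0 \<le> r * D" using r D by simp
      ultimately show ?thesis using 0 r by (simp add: power2_eq_square algebra_simps)
    next
      case (Suc k')
      have "r * (r ^ k * (r * C)) \<le> 1 * (r ^ k * (r * C))" using r C by (intro mult_right_mono) auto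
      moreover have "0 \<le> r ^ k * r" using r by simp
      ultimately show ?thesis using Suc by (simp add: power2_eq_square algebra_simps)
    qed
    also have "\<dots> \<le> r ^ k * (e / 4)"
      using r C D by (intro mult_left_mono) (auto simp: field_simps)
    finally have "cmod (complex_of_real (r\<^sup>2) * ?E) \<le> (e / 4) * r ^ k"
      by (simp add: norm_mult norm_power mult.commute)
    then have "cmod ((fourier v \<xi> - (\<Sum>m\<le>k. hom_part m v \<xi>)) + complex_of_real (r\<^sup>2) * ?E)
        \<le> (e / 4) * r ^ k + (e / 4) * r ^ k"
      using \<rho>0(2)[of \<xi>] r by (intro norm_triangle_mono) (auto simp: r_def)
    then have "cmod ((fourier v \<xi> - (\<Sum>m\<le>k. hom_part m v \<xi>)) + complex_of_real (r\<^sup>2) * ?E) / (1 - r\<^sup>2)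
        \<le> (e / 2 * r ^ k) / (1 / 2)"
      using q r \<open>0 < e\<close> by (intro frac_le) auto
    then show ?thesis using eq by (simp add: r_def)
  qed
  with \<open>0 < \<rho>\<close> show ?thesis by blast
qed

section \<open>Lower bounds for L^2 norms\<close>

text \<open>Reduces a comparison of norms to one of integrals of squares. Only the values of the
  integrals enter, so it applies to functions not known to be measurable.\<close>

lemma L2_norm_on_scaled_mono:
  assumes "0 \<le> c"
    and le: "ennreal (c\<^sup>2) * (\<integral>\<^sup>+\<xi>\<in>S. ennreal ((cmod (g \<xi>))\<^sup>2) \<partial>lebesgue)
      \<le> (\<integral>\<^sup>+\<xi>\<in>T. ennreal ((cmod (f \<xi>))\<^sup>2) \<partial>lebesgue)"
  shows "ennreal c * L2_norm_on S g \<le> L2_norm_on T f"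
proof -
  define I where "I = (\<integral>\<^sup>+\<xi>\<in>S. ennreal ((cmod (g \<xi>))\<^sup>2) \<partial>lebesgue)"
  define J where "J = (\<integral>\<^sup>+\<xi>\<in>T. ennreal ((cmod (f \<xi>))\<^sup>2) \<partial>lebesgue)"
  have le': "ennreal (c\<^sup>2) * I \<le> J" using le by (simp add: I_def J_def)
  have L2: "L2_norm_on S g = (if I = \<infinity> then \<infinity> else ennreal (sqrt (enn2real I)))"
    "L2_norm_on T f = (if J = \<infinity> then \<infinity> else ennreal (sqrt (enn2real J)))"
    by (simp_all add: L2_norm_on_def I_def J_def Let_def)
  show ?thesis
  \<comment> \<open>The square root is taken in the reals, so infinite values are split off. For
    \<open>c = 0\<close> the left side is 0 even if the norm is infinite; otherwise I is finite
    whenever J is.\<close>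
  proof (cases "J = \<infinity> \<or> c = 0")
    case True
    then show ?thesis by (auto simp: L2)
  next
    case False
    then have c: "0 < c" and J: "J \<noteq> \<infinity>" using \<open>0 \<le> c\<close> by auto
    have I: "I \<noteq> \<infinity>" using le' J c by (auto simp: ennreal_mult_top top_unique)
    have "c\<^sup>2 * enn2real I = enn2real (ennreal (c\<^sup>2) * I)"
      by (simp add: enn2real_mult)
    also have "\<dots> \<le> enn2real J"
      using le' J by (intro enn2real_mono) (auto simp: less_top)
    finally have "sqrt (c\<^sup>2 * enn2real I) \<le> sqrt (enn2real J)" by simp
    then have "c * sqrt (enn2real I) \<le> sqrt (enn2real J)"
      using c by (simp add: real_sqrt_mult)
    then show ?thesis
      using I J c by (simp add: L2 ennreal_leI flip: ennreal_mult)
  qed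
qed

lemma nn_integral_lborel_scale:
  fixes f :: "'a::euclidean_space \<Rightarrow> ennreal"
  assumes [measurable]: "f \<in> borel_measurable borel" and "0 < s"
  shows "(\<integral>\<^sup>+x. f x \<partial>lborel) = ennreal (s ^ DIM('a)) * (\<integral>\<^sup>+x. f (s *\<^sub>R x) \<partial>lborel)"
  using \<open>0 < s\<close>
  by (subst lborel_affine[of s 0]) (simp_all add: nn_integral_density nn_integral_distr nn_integral_cmult)

text \<open>Integrating \<open>|B|^2 / 2 - h^2 \<le> |F|^2\<close>, which follows from \<open>|B| \<le> |F| + h\<close>, instead of using
  Minkowski's inequality avoids having to know that \<open>F t\<close> is measurable.\<close>

lemma L2_norm_lower_bound:
  fixes F :: "real \<Rightarrow> 'a::euclidean_space \<Rightarrow> complex" and B :: "'a \<Rightarrow> complex"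
  assumes cont: "continuous_on UNIV B"
    and hom: "\<And>c \<xi>. 0 \<le> c \<Longrightarrow> B (c *\<^sub>R \<xi>) = complex_of_real c ^ k * B \<xi>"
    and approx: "\<And>\<epsilon>. 0 < \<epsilon> \<Longrightarrow> \<forall>\<^sub>F t in at_top. \<forall>\<xi>. norm \<xi> \<le> t powr (-1/2) / 2 \<longrightarrow>
      cmod (F t \<xi> - B \<xi> * complex_of_real (exp (- t * (norm \<xi>)\<^sup>2))) \<le> \<epsilon> * (t powr (-1/2)) ^ k"
  shows "\<forall>\<^sub>F t in at_top. ennreal (1 / 2) *
      L2_norm_on {\<xi>. norm \<xi> \<le> 1 / 2} (\<lambda>\<xi>. B \<xi> * complex_of_real (exp (- (norm \<xi>)\<^sup>2))) *
      ennreal (t powr (- real DIM('a) / 4 - real k / 2)) \<le> L2_norm (F t)"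
proof -
  let ?S = "cball (0 :: 'a) (1 / 2)"
  define G where "G = (\<lambda>\<xi>. B \<xi> * complex_of_real (exp (- (norm \<xi>)\<^sup>2)))"
  define I where "I = (\<integral>\<^sup>+\<xi>\<in>?S. ennreal ((cmod (G \<xi>))\<^sup>2) \<partial>lborel)"
  have S: "{\<xi> :: 'a. norm \<xi> \<le> 1 / 2} = ?S" by auto
  have contG: "continuous_on A G" for A
    unfolding G_def by (intro continuous_intros continuous_on_subset[OF cont]) auto
  have [measurable]: "G \<in> borel_measurable borel" "B \<in> borel_measurable borel"
    using contG[of UNIV] cont by (auto intro: borel_measurable_continuous_onI)
  have [measurable]: "?S \<in> sets borel" by simp
  have I: "(\<integral>\<^sup>+\<xi>\<in>?S. ennreal ((cmod (G \<xi>))\<^sup>2) \<partial>lebesgue) = I"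
    by (simp add: I_def nn_integral_completion)
  have V: "emeasure lborel ?S = ennreal (measure lborel ?S)"
    using emeasure_lborel_cball_finite[of "0 :: 'a" "1 / 2"] by (intro emeasure_eq_ennreal_measure) simp
  \<comment> \<open>The tolerance \<epsilon> will be chosen in proportion to I, which therefore has
    to be a real number.\<close>
  have "I \<noteq> \<infinity>"
  proof -
    have "compact (G ` ?S)" by (intro compact_continuous_image contG compact_cball)
    then obtain K where K: "\<And>\<xi>. \<xi> \<in> ?S \<Longrightarrow> cmod (G \<xi>) \<le> K"
      by (force dest!: compact_imp_bounded simp: bounded_iff)
    have "I \<le> (\<integral>\<^sup>+\<xi>\<in>?S. ennreal (K\<^sup>2) \<partial>lborel)"
      unfolding I_def using K
      by (intro nn_integral_mono) (auto simp: indicator_def intro!: ennreal_leI power_mono)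
    also have "\<dots> = ennreal (K\<^sup>2) * ennreal (measure lborel ?S)"
      by (simp add: nn_integral_cmult_indicator V)
    also have "\<dots> < \<infinity>" by (simp flip: ennreal_mult)
    finally show ?thesis by simp
  qed
  then obtain a where a: "I = ennreal a" "0 \<le> a" by (cases I) auto
  show ?thesis
  \<comment> \<open>For \<open>a = 0\<close> no positive \<epsilon> would be small enough, but then
    the claimed lower bound is 0.\<close>
  proof (cases "a = 0")
    case True
    then have "L2_norm_on {\<xi>. norm \<xi> \<le> 1 / 2} G = 0"
      unfolding S L2_norm_on_def I a by simp
    then show ?thesis by (simp add: G_def)
  next
    case False
    define V where "V = measure lborel ?S"
    \<comment> \<open>Chosen so that \<epsilon>^2 integrated over the ball costs at most a/4, half
      of what |G|^2 / 2 contributes.\<close>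
    define \<epsilon> where "\<epsilon> = sqrt (a / (4 * (V + 1)))"
    have "0 \<le> V" by (simp add: V_def)
    have \<epsilon>: "0 < \<epsilon>" "\<epsilon>\<^sup>2 * V \<le> a / 4"
    proof -
      show "0 < \<epsilon>" using False a \<open>0 \<le> V\<close> by (simp add: \<epsilon>_def)
      have "\<epsilon>\<^sup>2 * V = a / 4 * (V / (V + 1))"
        using a \<open>0 \<le> V\<close> by (simp add: \<epsilon>_def)
      also have "\<dots> \<le> a / 4 * 1"
        using a \<open>0 \<le> V\<close> by (intro mult_left_mono) auto
      finally show "\<epsilon>\<^sup>2 * V \<le> a / 4" by simp
    qed
    \<comment> \<open>As \<open>ennreal\<close> sends negative numbers to 0, this integrates the
      positive part of |G|^2 / 2 - \<epsilon>^2.\<close>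
    define X where "X = (\<integral>\<^sup>+\<eta>\<in>?S. ennreal ((cmod (G \<eta>))\<^sup>2 / 2 - \<epsilon>\<^sup>2) \<partial>lborel)"
    have X: "ennreal (a / 4) \<le> X"
    proof -
      have half: "ennreal (1 / 2) * ennreal y = ennreal (y / 2)" if "0 \<le> y" for y
        using ennreal_mult[of "1 / 2" y] that by simp
      \<comment> \<open>The chain bounds a/2, split as a/4 + a/4, by X + a/4; the finite a/4 then
        cancels.\<close>
      have "ennreal (a / 4) + ennreal (a / 4) = ennreal (1 / 2 * a)"
        using a by (simp flip: ennreal_plus)
      also have "\<dots> = ennreal (1 / 2) * I"
        unfolding a(1) using a(2) by (intro ennreal_mult) auto
      also have "\<dots> = (\<integral>\<^sup>+\<eta>. ennreal (1 / 2) * (ennreal ((cmod (G \<eta>))\<^sup>2) * indicator ?S \<eta>) \<partial>lborel)"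
        unfolding I_def by (rule nn_integral_cmult[symmetric]) measurable
      also have "\<dots> = (\<integral>\<^sup>+\<eta>\<in>?S. ennreal ((cmod (G \<eta>))\<^sup>2 / 2) \<partial>lborel)"
        by (simp only: half[OF zero_le_power2] flip: mult.assoc)
      also have "\<dots> \<le> (\<integral>\<^sup>+\<eta>. ennreal ((cmod (G \<eta>))\<^sup>2 / 2 - \<epsilon>\<^sup>2) * indicator ?S \<eta> +
          ennreal (\<epsilon>\<^sup>2) * indicator ?S \<eta> \<partial>lborel)"
      proof (intro nn_integral_mono)
        fix \<eta> :: 'a
        have "ennreal ((cmod (G \<eta>))\<^sup>2 / 2) \<le> ennreal (max 0 ((cmod (G \<eta>))\<^sup>2 / 2 - \<epsilon>\<^sup>2) + \<epsilon>\<^sup>2)"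
          by (intro ennreal_leI) linarith
        also have "\<dots> = ennreal ((cmod (G \<eta>))\<^sup>2 / 2 - \<epsilon>\<^sup>2) + ennreal (\<epsilon>\<^sup>2)"
          by (subst ennreal_plus) (auto simp: max_def ennreal_neg)
        finally show "ennreal ((cmod (G \<eta>))\<^sup>2 / 2) * indicator ?S \<eta> \<le>
            ennreal ((cmod (G \<eta>))\<^sup>2 / 2 - \<epsilon>\<^sup>2) * indicator ?S \<eta> + ennreal (\<epsilon>\<^sup>2) * indicator ?S \<eta>"
          by (auto simp: indicator_def)
      qed
      also have "\<dots> = X + ennreal (\<epsilon>\<^sup>2) * ennreal V"
        unfolding X_def V_def
        by (subst nn_integral_add) (auto simp: nn_integral_cmult_indicator V)
      also have "\<dots> \<le> X + ennreal (a / 4)"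
        using \<epsilon> \<open>0 \<le> V\<close> by (intro add_left_mono) (simp add: ennreal_leI flip: ennreal_mult)
      finally show ?thesis by (simp add: add_right_mono ennreal_add_left_cancel_le add.commute)
    qed
    show ?thesis
      using approx[OF \<epsilon>(1)] eventually_gt_at_top[of 0]
    proof eventually_elim
      case (elim t)
      \<comment> \<open>With s^2 t = 1, the substitution \<xi> = s \<eta> turns exp (- t |\<xi>|^2)
        into exp (- |\<eta>|^2) and the ball of radius s/2 into the fixed ball.\<close>
      define s where "s = t powr (-1/2)"
      have s: "0 < s" "s\<^sup>2 * t = 1"
        using elim(2) by (simp_all add: s_def power2_eq_square flip: powr_add)
      \<comment> \<open>A Borel minorant of |F t|^2 supported in the shrinking ball; the change of
        variables is carried out on it.\<close>
      define \<Phi> where "\<Phi> = (\<lambda>\<xi>. ennreal ((cmod (B \<xi> * complex_of_real (exp (- t * (norm \<xi>)\<^sup>2))))\<^sup>2 / 2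
        - \<epsilon>\<^sup>2 * (s ^ k)\<^sup>2) * indicator (cball 0 (s / 2)) \<xi>)"
      have [measurable]: "\<Phi> \<in> borel_measurable borel"
      proof -
        have [measurable]: "cball (0 :: 'a) (s / 2) \<in> sets borel" by simp
        show ?thesis unfolding \<Phi>_def by measurable
      qed
      have \<Phi>_scale: "\<Phi> (s *\<^sub>R \<eta>) =
        ennreal ((s ^ k)\<^sup>2) * (ennreal ((cmod (G \<eta>))\<^sup>2 / 2 - \<epsilon>\<^sup>2) * indicator ?S \<eta>)" for \<eta>
      proof -
        have "t * (norm (s *\<^sub>R \<eta>))\<^sup>2 = (s\<^sup>2 * t) * (norm \<eta>)\<^sup>2"
          by (simp add: power_mult_distrib)
        then have "B (s *\<^sub>R \<eta>) * complex_of_real (exp (- t * (norm (s *\<^sub>R \<eta>))\<^sup>2)) = complex_of_real s ^ k * G \<eta>"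
          using s hom[of s \<eta>] by (simp add: G_def)
        then have "(cmod (B (s *\<^sub>R \<eta>) * complex_of_real (exp (- t * (norm (s *\<^sub>R \<eta>))\<^sup>2))))\<^sup>2 / 2 - \<epsilon>\<^sup>2 * (s ^ k)\<^sup>2
            = (s ^ k)\<^sup>2 * ((cmod (G \<eta>))\<^sup>2 / 2 - \<epsilon>\<^sup>2)"
          using s by (simp add: norm_mult norm_power power_mult_distrib algebra_simps)
        moreover have "indicator (cball 0 (s / 2)) (s *\<^sub>R \<eta>) = (indicator ?S \<eta> :: ennreal)"
          using s by (auto simp: indicator_def)
        ultimately show ?thesis
          by (simp add: \<Phi>_def ennreal_mult' mult.assoc)
      qed
      have \<Phi>_le: "\<Phi> \<xi> \<le> ennreal ((cmod (F t \<xi>))\<^sup>2)" for \<xi>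
      proof (cases "norm \<xi> \<le> s / 2")
        case True
        define b where "b = B \<xi> * complex_of_real (exp (- t * (norm \<xi>)\<^sup>2))"
        have "cmod (F t \<xi> - b) \<le> \<epsilon> * s ^ k"
          using elim(1) True by (simp add: b_def s_def)
        moreover have "cmod b \<le> cmod (F t \<xi>) + cmod (F t \<xi> - b)"
          by (metis norm_minus_commute norm_triangle_sub)
        ultimately have "cmod b \<le> cmod (F t \<xi>) + \<epsilon> * s ^ k" by simp
        \<comment> \<open>The inequality (x + y)^2 \<le> 2 x^2 + 2 y^2 is the source of the division
          by 2 in \<Phi>.\<close>
        then have "(cmod b)\<^sup>2 \<le> (cmod (F t \<xi>) + \<epsilon> * s ^ k)\<^sup>2" by (rule power_mono) simp
        also have "\<dots> \<le> 2 * (cmod (F t \<xi>))\<^sup>2 + 2 * (\<epsilon> * s ^ k)\<^sup>2"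
          using zero_le_power2[of "cmod (F t \<xi>) - \<epsilon> * s ^ k"] by (simp add: power2_sum power2_diff)
        finally have "(cmod b)\<^sup>2 / 2 - \<epsilon>\<^sup>2 * (s ^ k)\<^sup>2 \<le> (cmod (F t \<xi>))\<^sup>2"
          by (simp add: power_mult_distrib)
        then show ?thesis
          using True by (simp add: \<Phi>_def b_def ennreal_leI)
      qed (simp add: \<Phi>_def)
      \<comment> \<open>The full factor in the claim. Its square consists of the Jacobian s^n, the
        factor s^(2k) from homogeneity, and the 1/4 from the bound on X.\<close>
      define c where "c = 1 / 2 * t powr (- real DIM('a) / 4 - real k / 2)"
      have "s ^ n = t powr (- real n / 2)" for n
        using elim(2) s by (simp add: s_def powr_powr flip: powr_realpow)
      moreover have "(t powr (- real DIM('a) / 4 - real k / 2))\<^sup>2 =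
          t powr (- real DIM('a) / 2) * (t powr (- real k / 2))\<^sup>2"
        unfolding power2_eq_square powr_add[symmetric]
        by (rule arg_cong[where f = "(powr) t"]) linarith
      ultimately have c: "c\<^sup>2 = s ^ DIM('a) * (s ^ k)\<^sup>2 / 4"
        by (simp only: c_def power_mult_distrib) (simp add: power2_eq_square)
      have "ennreal (c\<^sup>2) * I = ennreal (s ^ DIM('a)) * (ennreal ((s ^ k)\<^sup>2) * ennreal (a / 4))"
        using s a by (simp add: c flip: ennreal_mult)
      also have "\<dots> \<le> ennreal (s ^ DIM('a)) * (ennreal ((s ^ k)\<^sup>2) * X)"
        by (intro mult_left_mono X) auto
      also have "\<dots> = ennreal (s ^ DIM('a)) * (\<integral>\<^sup>+\<eta>. \<Phi> (s *\<^sub>R \<eta>) \<partial>lborel)"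
        unfolding \<Phi>_scale X_def by (subst nn_integral_cmult) auto
      also have "\<dots> = (\<integral>\<^sup>+\<xi>. \<Phi> \<xi> \<partial>lebesgue)"
        using s by (simp add: nn_integral_completion flip: nn_integral_lborel_scale)
      also have "\<dots> \<le> (\<integral>\<^sup>+\<xi>\<in>UNIV. ennreal ((cmod (F t \<xi>))\<^sup>2) \<partial>lebesgue)"
        using \<Phi>_le by (intro nn_integral_mono) simp
      finally have "ennreal c * L2_norm_on ?S G \<le> L2_norm (F t)"
        by (intro L2_norm_on_scaled_mono) (simp_all add: I c_def)
      moreover have "ennreal c = ennreal (1 / 2) * ennreal (t powr (- real DIM('a) / 4 - real k / 2))"
        unfolding c_def by (rule ennreal_mult) auto
      ultimately show ?case
        by (simp only: S G_def mult_ac)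
    qed
  qed
qed

section \<open>The solution formula and the conclusion\<close>

text \<open>Grouping by exponentials: the initial data enter the factor of exp (- t r^2) only
  through their sum, and the rest carries exp (- t), which decays faster than every power of t.
  Where |\<xi>| = 1 all quotients are 0, so the identity persists.\<close>

lemma u_hat_minus_profile:
  assumes "fourier v \<xi> = fourier u0 \<xi> + fourier u1 \<xi>"
  shows "u_hat u0 u1 t \<xi> - A * complex_of_real (exp (- t * (norm \<xi>)\<^sup>2)) -
      B * complex_of_real (exp (- t * (norm \<xi>)\<^sup>2)) =
    complex_of_real (exp (- t * (norm \<xi>)\<^sup>2)) * (fourier v \<xi> / complex_of_real (1 - (norm \<xi>)\<^sup>2) - A - B) -
    complex_of_real (exp (- t)) * ((complex_of_real ((norm \<xi>)\<^sup>2) * fourier u0 \<xi> + fourier u1 \<xi>) /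
      complex_of_real (1 - (norm \<xi>)\<^sup>2))"
  unfolding u_hat_def assms
  by (simp add: diff_divide_distrib add_divide_distrib algebra_simps)

theorem theorem4p2:
  fixes u0 u1 v :: "real ^ 'n \<Rightarrow> complex" and k :: nat
  assumes "u0 \<in> L2_space \<inter> weighted_L1 (real k)"
    and "u1 \<in> L2_space \<inter> weighted_L1 (real k)"
    and "v = (\<lambda>x. u0 x + u1 x)"
  shows "\<exists>\<delta>::real. \<delta> \<ge> 1 \<and> (\<forall>t\<ge>\<delta>.
    L2_norm (\<lambda>\<xi>. u_hat u0 u1 t \<xi>
        - profile_A (int k - 1) v \<xi> * complex_of_real (exp (- t * (norm \<xi>)\<^sup>2)))
    \<ge> ennreal (1 / 2)
        * L2_norm_on {\<xi>. norm \<xi> \<le> 1 / 2}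
            (\<lambda>\<xi>. profile_B k v \<xi> * complex_of_real (exp (- (norm \<xi>)\<^sup>2)))
        * ennreal (t powr (- real CARD('n) / 4 - real k / 2)))"
proof -
  have v: "v \<in> weighted_L1 (real k)"
    using assms weighted_L1_add by auto
  have "integrable lebesgue u0" "integrable lebesgue u1"
    using assms by (auto simp: weighted_L1_def)
  then have fourier_v: "fourier v \<xi> = fourier u0 \<xi> + fourier u1 \<xi>" for \<xi>
    using assms(3) fourier_add by blast
  define M where "M = (\<integral>x. cmod (u0 x) \<partial>lebesgue) + (\<integral>x. cmod (u1 x) \<partial>lebesgue)"
  let ?F = "\<lambda>t \<xi>. u_hat u0 u1 t \<xi> - profile_A (int k - 1) v \<xi> * complex_of_real (exp (- t * (norm \<xi>)\<^sup>2))"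
  \<comment> \<open>This is the hypothesis \<open>approx\<close> of
    \<open>L2_norm_lower_bound\<close>. Half of \<epsilon> goes to the expansion at the origin, half
    to the exp (- t) term.\<close>
  have "\<forall>\<^sub>F t in at_top. \<forall>\<xi>. norm \<xi> \<le> t powr (-1/2) / 2 \<longrightarrow>
      cmod (?F t \<xi> - profile_B k v \<xi> * complex_of_real (exp (- t * (norm \<xi>)\<^sup>2))) \<le> \<epsilon> * (t powr (-1/2)) ^ k"
    if "0 < \<epsilon>" for \<epsilon>
  proof -
    obtain \<rho> where \<rho>: "0 < \<rho>" "\<And>\<xi>. norm \<xi> \<le> \<rho> \<Longrightarrow>
        cmod (fourier v \<xi> / complex_of_real (1 - (norm \<xi>)\<^sup>2) - profile_A (int k - 1) v \<xi> - profile_B k v \<xi>)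
          \<le> \<epsilon> / 2 * norm \<xi> ^ k"
      using profile_expansion[OF v, of "\<epsilon> / 2"] \<open>0 < \<epsilon>\<close> by auto
    have "((\<lambda>t::real. t powr (-1/2)) \<longlongrightarrow> 0) at_top" by real_asymp
    then have 1: "\<forall>\<^sub>F t in at_top. t powr (-1/2) < \<rho>"
      using \<rho>(1) by (rule order_tendstoD)
    \<comment> \<open>On the ball, 2 M bounds the quotient multiplying exp (- t), since its
      denominator is at least 1/2; the power of t compensates s^k.\<close>
    have "((\<lambda>t::real. 2 * M * (exp (- t) * t powr (real k / 2))) \<longlongrightarrow> 2 * M * 0) at_top"
      by (intro tendsto_mult tendsto_const) real_asymp
    then have 2: "\<forall>\<^sub>F t in at_top. 2 * M * (exp (- t) * t powr (real k / 2)) < \<epsilon> / 2"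
      using \<open>0 < \<epsilon>\<close> by (intro order_tendstoD) auto
    show ?thesis
      using 1 2 eventually_ge_at_top[of 1]
    proof eventually_elim
      case (elim t)
      define s where "s = t powr (-1/2)"
      \<comment> \<open>From s \<le> 1 the ball of radius s/2 stays within |\<xi>| \<le> 1/2, away
        from the zero of 1 - r^2; from s < \<rho> the expansion is valid on it.\<close>
      have s: "0 < s" "s \<le> 1" "s < \<rho>"
        using elim by (auto simp: s_def powr_minus divide_simps ge_one_powr_ge_zero)
      have "s ^ k * t powr (real k / 2) = 1"
        using elim(3) s(1) by (simp add: s_def powr_powr flip: powr_realpow powr_add)
      then have "2 * M * exp (- t) = 2 * M * (exp (- t) * t powr (real k / 2)) * s ^ k"
        by (simp add: mult.assoc mult.commute[of "s ^ k"])
      also have "\<dots> \<le> \<epsilon> / 2 * s ^ k"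
        using elim(2) s by (intro mult_right_mono) auto
      finally have tail: "2 * M * exp (- t) \<le> \<epsilon> / 2 * s ^ k" .
      have "cmod (?F t \<xi> - profile_B k v \<xi> * complex_of_real (exp (- t * (norm \<xi>)\<^sup>2))) \<le> \<epsilon> * s ^ k"
        if \<xi>: "norm \<xi> \<le> s / 2" for \<xi>
      proof -
        define q where "q = 1 - (norm \<xi>)\<^sup>2"
        have "(norm \<xi>)\<^sup>2 \<le> (1 / 2)\<^sup>2"
          using \<xi> s by (intro power_mono) auto
        then have q: "1 / 2 \<le> q" and r: "(norm \<xi>)\<^sup>2 \<le> 1"
          by (simp_all add: q_def power2_eq_square)
        have "cmod (complex_of_real (exp (- t * (norm \<xi>)\<^sup>2)) *
            (fourier v \<xi> / complex_of_real q - profile_A (int k - 1) v \<xi> - profile_B k v \<xi>))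
            \<le> 1 * (\<epsilon> / 2 * norm \<xi> ^ k)"
          unfolding norm_mult q_def
          using \<xi> s elim(3) \<open>0 < \<epsilon>\<close> by (intro mult_mono \<rho>(2)) auto
        also have "\<dots> \<le> \<epsilon> / 2 * s ^ k"
          using \<xi> s \<open>0 < \<epsilon>\<close> by (auto intro!: mult_left_mono power_mono)
        finally have main: "cmod (complex_of_real (exp (- t * (norm \<xi>)\<^sup>2)) *
            (fourier v \<xi> / complex_of_real q - profile_A (int k - 1) v \<xi> - profile_B k v \<xi>))
            \<le> \<epsilon> / 2 * s ^ k" .
        have "cmod (complex_of_real ((norm \<xi>)\<^sup>2) * fourier u0 \<xi>) \<le> 1 * (\<integral>x. cmod (u0 x) \<partial>lebesgue)"
          unfolding norm_mult norm_of_real using r by (intro mult_mono fourier_bound) auto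
        then have "cmod (complex_of_real ((norm \<xi>)\<^sup>2) * fourier u0 \<xi> + fourier u1 \<xi>) \<le> M"
          using fourier_bound[of u1 \<xi>] by (simp add: M_def norm_triangle_mono)
        moreover have "0 \<le> M" by (simp add: M_def)
        ultimately have "cmod ((complex_of_real ((norm \<xi>)\<^sup>2) * fourier u0 \<xi> + fourier u1 \<xi>) / complex_of_real q)
            \<le> M / (1 / 2)"
          unfolding norm_divide norm_of_real using q by (intro frac_le) auto
        then have "cmod (complex_of_real (exp (- t)) *
            ((complex_of_real ((norm \<xi>)\<^sup>2) * fourier u0 \<xi> + fourier u1 \<xi>) / complex_of_real q))
            \<le> exp (- t) * (M / (1 / 2))"
          unfolding norm_mult[of "complex_of_real (exp (- t))"] by (simp add: mult_left_mono)
        with tail have "cmod (complex_of_real (exp (- t)) *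
            ((complex_of_real ((norm \<xi>)\<^sup>2) * fourier u0 \<xi> + fourier u1 \<xi>) / complex_of_real q))
            \<le> \<epsilon> / 2 * s ^ k"
          by (simp add: mult_ac)
        from norm_triangle_ineq4[THEN order_trans, OF add_mono, OF main this] show ?thesis
          unfolding u_hat_minus_profile[OF fourier_v] q_def by simp
      qed
      then show ?case by (simp add: s_def)
    qed
  qed
  from L2_norm_lower_bound[OF continuous_on_profile_B profile_B_scaleR this]
  obtain N where "\<forall>t\<ge>N. ennreal (1 / 2) *
      L2_norm_on {\<xi>. norm \<xi> \<le> 1 / 2} (\<lambda>\<xi>. profile_B k v \<xi> * complex_of_real (exp (- (norm \<xi>)\<^sup>2))) *
      ennreal (t powr (- real CARD('n) / 4 - real k / 2)) \<le> L2_norm (?F t)"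
    by (auto simp: eventually_at_top_linorder)
  then show ?thesis
    by (intro exI[of _ "max 1 N"]) auto
qed

end
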